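(* Let $u,v\in H^2(\mathbb{D})$ be nonzero and let $T=S+u\otimes v$ on $H^2(\mathbb{D})$. If $T$ is quasinormal, then $\ker(I-T^*T)=\theta H^2(\mathbb{D})$, where $\theta$ is either a single Blaschke factor or a product of two Blaschke factors.
   Context: $H^2(\mathbb{D})$ is the Hardy space on the open unit disc $\mathbb{D}$; $S$ is the unilateral shift of multiplicity one (multiplication by $z$) on it. For nonzero $u,v$, $u\otimes v$ is the rank-one operator $(u\otimes v)f=\langle f,v\rangle u$. An operator $T$ is quasinormal if it commutes with $T^*T$. $I$ is the identity operator. A Blaschke factor is a function $B_\alpha(z)=\frac{z-\alpha}{1-\bar\alpha z}$, $z\in\mathbb{D}$, with $\alpha\in\mathbb{D}$.
   Formalization: The formal theorem additionally assumes that T is not an isometry; otherwise (e.g. v = 1, u = 1 − z) T is quasinormal but ker(I − T*T) is all of H², which is never θH² for θ a Blaschke factor or a product of two. *)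

theory Defs
  imports "HOL-Complex_Analysis.Complex_Analysis"
begin

definition taylor_coeff :: "(complex \<Rightarrow> complex) \<Rightarrow> nat \<Rightarrow> complex" where
  "taylor_coeff f n = (deriv ^^ n) f 0 / fact n"

text \<open>
  Elements of the Hardy space are functions on the open unit disc. They are represented by total
  functions that vanish outside the disc, so that equality of elements is equality in HOL.
\<close>

definition hardy2 :: "(complex \<Rightarrow> complex) set" where
  "hardy2 = {f. f holomorphic_on ball 0 1 \<and> (\<forall>z. z \<notin> ball 0 1 \<longrightarrow> f z = 0) \<and>
                summable (\<lambda>n. (norm (taylor_coeff f n))\<^sup>2)}"

definition hardy_inner :: "(complex \<Rightarrow> complex) \<Rightarrow> (complex \<Rightarrow> complex) \<Rightarrow> complex" where
  "hardy_inner f g = (\<Sum>n. taylor_coeff f n * cnj (taylor_coeff g n))"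

definition hardy_norm :: "(complex \<Rightarrow> complex) \<Rightarrow> real" where
  "hardy_norm f = sqrt (\<Sum>n. (norm (taylor_coeff f n))\<^sup>2)"

type_synonym hardy_op = "(complex \<Rightarrow> complex) \<Rightarrow> (complex \<Rightarrow> complex)"

text \<open>Only the values of a \<open>hardy_op\<close> at elements of \<^const>\<open>hardy2\<close> are meaningful.\<close>

definition hardy_shift :: hardy_op where
  "hardy_shift f = (\<lambda>z. z * f z)"

definition rank_one :: "(complex \<Rightarrow> complex) \<Rightarrow> (complex \<Rightarrow> complex) \<Rightarrow> hardy_op" where
  "rank_one u v f = (\<lambda>z. hardy_inner f v * u z)"

text \<open>
  For a bounded operator \<open>A\<close> and \<open>g\<close> in the Hardy space, the described element exists by the Riesz
  representation theorem and is unique.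
\<close>

definition hardy_adjoint :: "hardy_op \<Rightarrow> hardy_op" where
  "hardy_adjoint A g =
     (THE h. h \<in> hardy2 \<and> (\<forall>f\<in>hardy2. hardy_inner (A f) g = hardy_inner f h))"

definition quasinormal :: "hardy_op \<Rightarrow> bool" where
  "quasinormal A \<longleftrightarrow>
     (\<forall>f\<in>hardy2. A (hardy_adjoint A (A f)) = hardy_adjoint A (A (A f)))"

text \<open>
  Isometries have to be excluded in the theorem: for \<open>v = 1\<close> and \<open>u = 1 - z\<close> the operator
  \<open>T = S + u \<otimes> v\<close> is an isometry, hence quasinormal, and the kernel of \<open>I - T* T\<close> is the whole
  space, whereas every function in \<open>\<theta> H\<^sup>2\<close> vanishes at the zeros of \<open>\<theta>\<close>.
\<close>

definition hardy_isometry :: "hardy_op \<Rightarrow> bool" where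
  "hardy_isometry A \<longleftrightarrow> (\<forall>f\<in>hardy2. hardy_norm (A f) = hardy_norm f)"

definition hardy_kernel :: "hardy_op \<Rightarrow> (complex \<Rightarrow> complex) set" where
  "hardy_kernel A = {f \<in> hardy2. A f = (\<lambda>z. 0)}"

definition blaschke_factor :: "complex \<Rightarrow> complex \<Rightarrow> complex" where
  "blaschke_factor \<alpha> z = (z - \<alpha>) / (1 - cnj \<alpha> * z)"

end

theory Submission
  imports Defs
begin

text \<open>
  With \<open>w = S* u\<close> one computes
  \<open>(T* T - I) f = \<langle>f, v\<rangle> w + (\<langle>f, w\<rangle> + \<parallel>u\<parallel>\<^sup>2 \<langle>f, v\<rangle>) v\<close>.
  As \<open>T\<close> is not an isometry, the kernel \<open>K\<close> of this operator is the common kernel of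
  \<open>\<langle>\<cdot>, v\<rangle>\<close> and \<open>\<langle>\<cdot>, w\<rangle>\<close> if these are independent, and that of \<open>\<langle>\<cdot>, v\<rangle>\<close> otherwise. Quasinormality
  makes \<open>K\<close> invariant under \<open>T\<close>, and \<open>T = S\<close> on \<open>K\<close>; so \<open>K\<close> is invariant under \<open>S\<close>.

  Beurling's theorem is not needed for this finite codimension. A nonzero functional \<open>L\<close> with
  \<open>L S = \<beta> L\<close> that tends to \<open>0\<close> along \<open>S\<^sup>n f\<close> has \<open>|\<beta>| < 1\<close>, and \<open>f - f(\<beta>) = (z - \<beta>) g\<close> with \<open>g\<close> in
  the Hardy space shows \<open>L f = f(\<beta>) L 1\<close>; hence \<open>ker L = B\<^sub>\<beta> H\<^sup>2\<close>. In codimension two, \<open>S\<close> acts on the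
  plane of functionals vanishing on \<open>K\<close>; an eigenvector of this action gives a first Blaschke factor,
  and dividing by it reduces to codimension one.
\<close>

subsection \<open>The Hardy space in terms of Taylor coefficients\<close>

lemma hardy_sums:
  assumes "f \<in> hardy2" "norm z < 1"
  shows "(\<lambda>n. taylor_coeff f n * z ^ n) sums f z"
  using holomorphic_power_series[of f 0 1 z] assms
  by (simp add: hardy2_def taylor_coeff_def)

lemma hardy_outside: "f \<in> hardy2 \<Longrightarrow> \<not> norm z < 1 \<Longrightarrow> f z = 0"
  by (auto simp: hardy2_def)

lemma hardy_summable: "f \<in> hardy2 \<Longrightarrow> summable (\<lambda>n. (norm (taylor_coeff f n))\<^sup>2)"
  by (simp add: hardy2_def)

lemma hardy_eqI:
  assumes "f \<in> hardy2" "g \<in> hardy2" "\<And>n. taylor_coeff f n = taylor_coeff g n"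
  shows "f = g"
proof
  fix z show "f z = g z"
  proof (cases "norm z < 1")
    case True
    then show ?thesis
      using hardy_sums[of f z] hardy_sums[of g z] assms by (simp add: sums_iff)
  qed (simp add: assms hardy_outside)
qed

text \<open>Convergence of the series makes \<open>f\<close> analytic, and uniqueness of the
  expansion at 0 identifies the coefficients. Elements are thus handled through square-summable
  sequences instead of iterated derivatives.\<close>

lemma hardyI:
  assumes summ: "summable (\<lambda>n. (norm (c n))\<^sup>2)"
    and sums: "\<And>z. norm z < 1 \<Longrightarrow> (\<lambda>n. c n * z ^ n) sums f z"
    and out: "\<And>z. \<not> norm z < 1 \<Longrightarrow> f z = 0"
  shows "f \<in> hardy2" "taylor_coeff f = c"
proof -
  have "f analytic_on ball 0 1"
    by (rule power_series_analytic[of 0 1 c]) (use sums in simp)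
  then have hol: "f holomorphic_on ball 0 1"
    by (rule analytic_imp_holomorphic)
  have "f has_fps_expansion Abs_fps c"
  proof (rule has_fps_expansionI)
    have "\<forall>\<^sub>F u in nhds 0. u \<in> ball (0::complex) 1"
      by (intro eventually_nhds_in_open) auto
    then show "\<forall>\<^sub>F u in nhds 0. (\<lambda>n. fps_nth (Abs_fps c) n * u ^ n) sums f u"
      by eventually_elim (use sums in simp)
  qed
  from fps_nth_fps_expansion[OF this] show c: "taylor_coeff f = c"
    by (simp add: taylor_coeff_def fun_eq_iff)
  show "f \<in> hardy2"
    using hol out summ c by (simp add: hardy2_def)
qed

definition hardy_of :: "(nat \<Rightarrow> complex) \<Rightarrow> complex \<Rightarrow> complex" where
  "hardy_of c z = (if norm z < 1 then \<Sum>n. c n * z ^ n else 0)"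

lemma square_summable_imp_bounded:
  fixes c :: "nat \<Rightarrow> complex"
  assumes "summable (\<lambda>n. (norm (c n))\<^sup>2)"
  obtains M where "\<And>n. norm (c n) \<le> M"
proof -
  have "(\<lambda>n. sqrt ((norm (c n))\<^sup>2)) \<longlonglongrightarrow> sqrt 0"
    using summable_LIMSEQ_zero[OF assms] by (rule tendsto_real_sqrt)
  then have "c \<longlonglongrightarrow> 0"
    by (simp add: tendsto_norm_zero_iff)
  then have "Bseq c"
    by (simp add: convergentI convergent_imp_Bseq)
  then show ?thesis
    using that by (auto simp: Bseq_def)
qed

lemma hardy_of:
  assumes "summable (\<lambda>n. (norm (c n))\<^sup>2)"
  shows "hardy_of c \<in> hardy2" "taylor_coeff (hardy_of c) = c"
proof -
  obtain M where M: "\<And>n. norm (c n) \<le> M"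
    using square_summable_imp_bounded[OF assms] by blast
  have "(\<lambda>n. c n * z ^ n) sums hardy_of c z" if z: "norm z < 1" for z
  proof -
    have "summable (\<lambda>n. c n * z ^ n)"
    proof (rule summable_comparison_test')
      show "summable (\<lambda>n. M * norm z ^ n)"
        using z by (intro summable_mult summable_geometric) simp
    qed (use M in \<open>simp add: norm_mult norm_power mult_right_mono\<close>)
    then show ?thesis
      using z by (simp add: hardy_of_def summable_sums)
  qed
  then show "hardy_of c \<in> hardy2" "taylor_coeff (hardy_of c) = c"
    using hardyI[of c "hardy_of c"] assms by (auto simp: hardy_of_def)
qed

text \<open>Termwise comparison through (x + y)^2 \<le> 2 x^2 + 2 y^2.\<close>

lemma square_summable_lincomb:
  fixes f g :: "nat \<Rightarrow> complex"
  assumes "summable (\<lambda>n. (norm (f n))\<^sup>2)" "summable (\<lambda>n. (norm (g n))\<^sup>2)"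
  shows "summable (\<lambda>n. (norm (a * f n + b * g n))\<^sup>2)"
proof (rule summable_comparison_test')
  show "summable (\<lambda>n. 2 * ((norm a)\<^sup>2 * (norm (f n))\<^sup>2) + 2 * ((norm b)\<^sup>2 * (norm (g n))\<^sup>2))"
    using assms by (intro summable_add summable_mult)
  fix n
  have "(norm (a * f n + b * g n))\<^sup>2 \<le> (norm a * norm (f n) + norm b * norm (g n))\<^sup>2"
    by (metis norm_ge_zero norm_mult norm_triangle_ineq power_mono)
  also have "\<dots> \<le> 2 * ((norm a)\<^sup>2 * (norm (f n))\<^sup>2) + 2 * ((norm b)\<^sup>2 * (norm (g n))\<^sup>2)"
    using sum_squares_bound[of "norm a * norm (f n)" "norm b * norm (g n)"]
    by (simp add: power2_sum power_mult_distrib)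
  finally show "norm ((norm (a * f n + b * g n))\<^sup>2)
    \<le> 2 * ((norm a)\<^sup>2 * (norm (f n))\<^sup>2) + 2 * ((norm b)\<^sup>2 * (norm (g n))\<^sup>2)"
    by simp
qed

text \<open>This single shape serves sums, differences and multiples alike, which is why functions
  are spelled \<open>1 * f z + - c * g z\<close> in what follows.\<close>

lemma hardy_lincomb:
  assumes "f \<in> hardy2" "g \<in> hardy2"
  shows "(\<lambda>z. a * f z + b * g z) \<in> hardy2"
    and "taylor_coeff (\<lambda>z. a * f z + b * g z) = (\<lambda>n. a * taylor_coeff f n + b * taylor_coeff g n)"
proof -
  have s: "(\<lambda>n. (a * taylor_coeff f n + b * taylor_coeff g n) * z ^ n) sums (a * f z + b * g z)"
    if "norm z < 1" for z
    using sums_add[OF sums_mult[OF hardy_sums[OF assms(1) that]] sums_mult[OF hardy_sums[OF assms(2) that]]]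
    by (simp add: algebra_simps)
  note h = hardyI[OF square_summable_lincomb[OF hardy_summable[OF assms(1)] hardy_summable[OF assms(2)]] s]
  show "(\<lambda>z. a * f z + b * g z) \<in> hardy2"
    and "taylor_coeff (\<lambda>z. a * f z + b * g z) = (\<lambda>n. a * taylor_coeff f n + b * taylor_coeff g n)"
    using h hardy_outside[OF assms(1)] hardy_outside[OF assms(2)] by auto
qed

lemma hardy_shift:
  assumes "f \<in> hardy2"
  shows "hardy_shift f \<in> hardy2"
    and "taylor_coeff (hardy_shift f) = case_nat 0 (taylor_coeff f)"
proof -
  let ?c = "case_nat 0 (taylor_coeff f)"
  have s: "(\<lambda>n. ?c n * z ^ n) sums hardy_shift f z" if "norm z < 1" for z
    using sums_mult[OF hardy_sums[OF assms that], of z]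
    by (subst sums_Suc_iff[symmetric, where f="\<lambda>n. ?c n * z ^ n", simplified])
      (simp add: hardy_shift_def algebra_simps)
  have "summable (\<lambda>n. (norm (?c n))\<^sup>2)"
    using hardy_summable[OF assms] by (subst summable_Suc_iff[symmetric]) simp
  from hardyI[OF this s] show "hardy_shift f \<in> hardy2" "taylor_coeff (hardy_shift f) = ?c"
    using hardy_outside[OF assms] by (auto simp: hardy_shift_def)
qed

lemma hardy_shift_funpow: "f \<in> hardy2 \<Longrightarrow> (hardy_shift ^^ n) f \<in> hardy2"
  by (induction n) (auto intro: hardy_shift)

lemma taylor_coeff_shift_funpow:
  "f \<in> hardy2 \<Longrightarrow>
    taylor_coeff ((hardy_shift ^^ n) f) k = (if k < n then 0 else taylor_coeff f (k - n))"
proof (induction n arbitrary: k)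
  case (Suc n)
  then show ?case
    by (cases k) (simp_all add: hardy_shift(2)[OF hardy_shift_funpow])
qed simp

section \<open>The inner product and its monomial test vectors\<close>

lemma inner_summable:
  assumes "f \<in> hardy2" "g \<in> hardy2"
  shows "summable (\<lambda>n. taylor_coeff f n * cnj (taylor_coeff g n))"
proof (rule summable_comparison_test')
  show "summable (\<lambda>n. (norm (taylor_coeff f n))\<^sup>2 + (norm (taylor_coeff g n))\<^sup>2)"
    using assms by (intro summable_add hardy_summable)
  fix n
  \<comment> \<open>The bound 2 x y \<le> x^2 + y^2 has a spare factor 2; nonnegativity of x y
    allows it to be dropped.\<close>
  have "0 \<le> norm (taylor_coeff f n) * norm (taylor_coeff g n)" by simp
  then show "norm (taylor_coeff f n * cnj (taylor_coeff g n))
      \<le> (norm (taylor_coeff f n))\<^sup>2 + (norm (taylor_coeff g n))\<^sup>2"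
    using sum_squares_bound[of "norm (taylor_coeff f n)" "norm (taylor_coeff g n)"]
    unfolding norm_mult complex_mod_cnj by linarith
qed

lemma hardy_inner_sums:
  "f \<in> hardy2 \<Longrightarrow> g \<in> hardy2 \<Longrightarrow>
    (\<lambda>n. taylor_coeff f n * cnj (taylor_coeff g n)) sums hardy_inner f g"
  unfolding hardy_inner_def by (intro summable_sums inner_summable)

lemma hardy_inner_cnj: "f \<in> hardy2 \<Longrightarrow> g \<in> hardy2 \<Longrightarrow> cnj (hardy_inner f g) = hardy_inner g f"
  using sums_unique[OF sums_cnj[THEN iffD2, OF hardy_inner_sums[of f g]]]
  by (simp add: hardy_inner_def mult.commute)

lemma hardy_inner_lincomb_left:
  assumes "f \<in> hardy2" "g \<in> hardy2" "h \<in> hardy2"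
  shows "hardy_inner (\<lambda>z. a * f z + b * g z) h = a * hardy_inner f h + b * hardy_inner g h"
  using sums_unique[OF sums_add[OF sums_mult[OF hardy_inner_sums[of f h], of a]
        sums_mult[OF hardy_inner_sums[of g h], of b]]] assms
  by (simp add: hardy_inner_def hardy_lincomb algebra_simps)

lemma hardy_inner_lincomb_right:
  assumes "f \<in> hardy2" "g \<in> hardy2" "h \<in> hardy2"
  shows "hardy_inner h (\<lambda>z. a * f z + b * g z) = cnj a * hardy_inner h f + cnj b * hardy_inner h g"
proof -
  have "hardy_inner h (\<lambda>z. a * f z + b * g z) = cnj (hardy_inner (\<lambda>z. a * f z + b * g z) h)"
    using assms hardy_lincomb by (simp add: hardy_inner_cnj)
  then show ?thesis
    using assms by (simp add: hardy_inner_lincomb_left hardy_inner_cnj)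
qed

lemma hardy_inner_self:
  assumes "f \<in> hardy2"
  shows "hardy_inner f f = complex_of_real ((hardy_norm f)\<^sup>2)"
proof -
  have "hardy_inner f f = (\<Sum>n. complex_of_real ((norm (taylor_coeff f n))\<^sup>2))"
    by (simp only: hardy_inner_def complex_norm_square)
  also have "\<dots> = complex_of_real (\<Sum>n. (norm (taylor_coeff f n))\<^sup>2)"
    using hardy_summable[OF assms] by (rule suminf_of_real[symmetric])
  finally show ?thesis
    using suminf_nonneg[OF hardy_summable[OF assms]] by (simp add: hardy_norm_def)
qed

text \<open>The power z^k cut off outside the disc. In particular \<open>hardy_monom 0\<close> plays
  the role of the constant 1, which as a total function does not lie in
  \<open>hardy2\<close>.\<close>

definition hardy_monom :: "nat \<Rightarrow> complex \<Rightarrow> complex" where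
  "hardy_monom k = hardy_of (\<lambda>n. if n = k then 1 else 0)"

lemma hardy_monom:
  "hardy_monom k \<in> hardy2" "taylor_coeff (hardy_monom k) = (\<lambda>n. if n = k then 1 else 0)"
proof -
  have "summable (\<lambda>n. (norm ((if n = k then 1 else 0) :: complex))\<^sup>2)"
    by (rule summable_finite[of "{k}"]) auto
  from hardy_of[OF this]
  show "hardy_monom k \<in> hardy2" "taylor_coeff (hardy_monom k) = (\<lambda>n. if n = k then 1 else 0)"
    by (auto simp: hardy_monom_def)
qed

lemma hardy_inner_monom: "hardy_inner (hardy_monom k) g = cnj (taylor_coeff g k)"
proof -
  have "hardy_inner (hardy_monom k) g = (\<Sum>n. if n = k then cnj (taylor_coeff g n) else 0)"
    by (simp add: hardy_inner_def hardy_monom if_distrib[of "\<lambda>x. x * _"] cong: if_cong)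
  also have "\<dots> = cnj (taylor_coeff g k)"
    using sums_unique[OF sums_single[of k "\<lambda>n. cnj (taylor_coeff g n)"]] by simp
  finally show ?thesis .
qed

text \<open>Pairing with monomials reads off the conjugated coefficients. This yields the uniqueness
  behind the \<open>THE\<close> in \<open>hardy_adjoint\<close>.\<close>

lemma hardy_inner_eqD:
  assumes "g \<in> hardy2" "h \<in> hardy2" "\<And>f. f \<in> hardy2 \<Longrightarrow> hardy_inner f g = hardy_inner f h"
  shows "g = h"
  using assms(3)[OF hardy_monom(1)] assms(1,2) by (intro hardy_eqI) (auto simp: hardy_inner_monom)

text \<open>Pairing S^n f with \<open>g\<close> involves only the coefficients of \<open>g\<close>
  from index n on, so Cauchy-Schwarz bounds it by the norm of \<open>f\<close> times the norm of a
  tail of \<open>g\<close>.\<close>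

lemma hardy_inner_shift_funpow_tendsto_0:
  assumes f: "f \<in> hardy2" and g: "g \<in> hardy2"
  shows "(\<lambda>n. hardy_inner ((hardy_shift ^^ n) f) g) \<longlonglongrightarrow> 0"
proof (rule tendsto_0_le[where K=1])
  let ?t = "\<lambda>n. \<Sum>k. (norm (taylor_coeff g (k + n)))\<^sup>2"
  have "(\<lambda>n. sqrt (?t n)) \<longlonglongrightarrow> sqrt 0"
    using suminf_exist_split2[OF hardy_summable[OF g]] by (rule tendsto_real_sqrt)
  then have "(\<lambda>n. hardy_norm f * sqrt (?t n)) \<longlonglongrightarrow> hardy_norm f * sqrt 0"
    by (intro tendsto_mult_left)
  then show "(\<lambda>n. hardy_norm f * sqrt (?t n)) \<longlonglongrightarrow> 0" by simp
  have "norm (hardy_inner ((hardy_shift ^^ n) f) g) \<le> hardy_norm f * sqrt (?t n)" for n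
  proof -
    let ?F = "(hardy_shift ^^ n) f"
    have "(\<lambda>k. taylor_coeff ?F k * cnj (taylor_coeff g k)) sums hardy_inner ?F g"
      by (rule hardy_inner_sums[OF hardy_shift_funpow[OF f] g])
    \<comment> \<open>The first n coefficients of S^n f vanish, so the index shift leaves the sum
      unchanged.\<close>
    then have "(\<lambda>k. taylor_coeff ?F (k + n) * cnj (taylor_coeff g (k + n))) sums hardy_inner ?F g"
      by (subst sums_iff_shift) (simp add: taylor_coeff_shift_funpow[OF f])
    then have s: "(\<lambda>k. taylor_coeff f k * cnj (taylor_coeff g (k + n))) sums hardy_inner ?F g"
      by (simp add: taylor_coeff_shift_funpow[OF f])
    have sg: "summable (\<lambda>k. (norm (taylor_coeff g (k + n)))\<^sup>2)"
      using hardy_summable[OF g] by (rule summable_ignore_initial_segment)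
    have "norm (\<Sum>k<N. taylor_coeff f k * cnj (taylor_coeff g (k + n))) \<le> hardy_norm f * sqrt (?t n)" for N
    proof -
      have "norm (\<Sum>k<N. taylor_coeff f k * cnj (taylor_coeff g (k + n)))
          \<le> (\<Sum>k<N. \<bar>norm (taylor_coeff f k)\<bar> * \<bar>norm (taylor_coeff g (k + n))\<bar>)"
        by (rule sum_norm_le) (simp add: norm_mult)
      also have "\<dots> \<le> L2_set (\<lambda>k. norm (taylor_coeff f k)) {..<N}
          * L2_set (\<lambda>k. norm (taylor_coeff g (k + n))) {..<N}"
        by (rule L2_set_mult_ineq)
      also have "\<dots> \<le> hardy_norm f * sqrt (?t n)"
        unfolding L2_set_def hardy_norm_def
        using hardy_summable[OF f] sg
        by (intro mult_mono real_sqrt_le_mono sum_le_suminf) (auto intro!: sum_nonneg suminf_nonneg)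
      finally show ?thesis .
    qed
    then show ?thesis
      using tendsto_norm[OF s[unfolded sums_def]] by (intro LIMSEQ_le_const2) auto
  qed
  then show "\<forall>\<^sub>F n in sequentially. norm (hardy_inner ((hardy_shift ^^ n) f) g)
      \<le> norm (hardy_norm f * sqrt (?t n)) * 1"
    by (intro always_eventually allI) (simp add: order_trans[OF _ abs_ge_self])
qed

subsection \<open>Division by linear factors\<close>

text \<open>The convexity of the square, applied to \<open>b + r a = (1 - r) (b / (1 - r)) + r a\<close>.\<close>

lemma square_convex_bound:
  fixes a b r x :: real
  assumes "0 \<le> r" "r < 1" "0 \<le> x" "x \<le> b + r * a"
  shows "x\<^sup>2 \<le> b\<^sup>2 / (1 - r) + r * a\<^sup>2"
proof -
  have "x\<^sup>2 \<le> (b + r * a)\<^sup>2"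
    using assms by (intro power_mono) auto
  also have "b\<^sup>2 / (1 - r) + r * a\<^sup>2 - (b + r * a)\<^sup>2 = r / (1 - r) * (b - (1 - r) * a)\<^sup>2"
    using assms by (simp add: field_simps power2_eq_square)
  then have "(b + r * a)\<^sup>2 \<le> b\<^sup>2 / (1 - r) + r * a\<^sup>2"
    using assms by (smt (verit) divide_nonneg_pos mult_nonneg_nonneg zero_le_power2)
  finally show ?thesis .
qed

text \<open>Summing the recursion bounds each partial sum by a constant plus \<open>r\<close> times
  itself; since \<open>r < 1\<close>, that multiple is absorbed on the left.\<close>

lemma summable_contraction_forward:
  fixes x y :: "nat \<Rightarrow> real"
  assumes r: "0 \<le> r" "r < 1" and x: "\<And>n. 0 \<le> x n" and y: "summable y" "\<And>n. 0 \<le> y n"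
    and rec: "\<And>n. x (Suc n) \<le> y n + r * x n"
  shows "summable x"
proof (rule summableI_nonneg_bounded[OF x])
  fix N
  have "sum x {..<Suc N} = x 0 + (\<Sum>n<N. x (Suc n))"
    by (rule sum.lessThan_Suc_shift)
  also have "\<dots> \<le> x 0 + (\<Sum>n<N. y n + r * x n)"
    by (intro add_left_mono sum_mono rec)
  also have "\<dots> \<le> x 0 + suminf y + r * sum x {..<N}"
    using sum_le_suminf[OF y(1), of "{..<N}"] y by (simp add: sum.distrib sum_distrib_left)
  finally have "(1 - r) * sum x {..<N} \<le> x 0 + suminf y"
    using x[of N] by (simp add: algebra_simps)
  then show "sum x {..<N} \<le> (x 0 + suminf y) / (1 - r)"
    using r by (simp add: field_simps)
qed

text \<open>Here the summed recursion brings in the last term \<open>x N\<close> in place of the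
  initial one; the uniform bound \<open>M\<close> controls it before the same absorption.\<close>

lemma summable_contraction_backward:
  fixes x y :: "nat \<Rightarrow> real"
  assumes r: "0 \<le> r" "r < 1" and x: "\<And>n. 0 \<le> x n" "\<And>n. x n \<le> M"
    and y: "summable y" "\<And>n. 0 \<le> y n"
    and rec: "\<And>n. x n \<le> y n + r * x (Suc n)"
  shows "summable x"
proof (rule summableI_nonneg_bounded[OF x(1)])
  fix N
  have "sum x {..<N} \<le> (\<Sum>n<N. y n + r * x (Suc n))"
    by (intro sum_mono rec)
  also have "\<dots> \<le> suminf y + r * (\<Sum>n<N. x (Suc n))"
    using sum_le_suminf[OF y(1), of "{..<N}"] y by (simp add: sum.distrib sum_distrib_left)
  also have "r * (\<Sum>n<N. x (Suc n)) \<le> r * (sum x {..<N} + M)"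
    using sum.lessThan_Suc_shift[of x N] x(1)[of 0] x(2)[of N] r by (intro mult_left_mono) auto
  finally have "(1 - r) * sum x {..<N} \<le> suminf y + r * M"
    by (simp add: algebra_simps)
  then show "sum x {..<N} \<le> (suminf y + r * M) / (1 - r)"
    using r by (simp add: field_simps)
qed

text \<open>The coefficients of h / (1 - c z) obey a forward recursion with ratio \<open>c\<close>,
  and \<open>square_convex_bound\<close> turns it into a contraction for their squares. In the
  product form the identity also holds outside the disc, where both sides vanish.\<close>

lemma hardy_resolvent:
  assumes h: "h \<in> hardy2" and c: "norm c < 1"
  obtains k where "k \<in> hardy2" "\<And>z. (1 - c * z) * k z = h z"
proof -
  define a where "a = rec_nat (taylor_coeff h 0) (\<lambda>n x. taylor_coeff h (Suc n) + c * x)"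
  have a: "a 0 = taylor_coeff h 0" "a (Suc n) = taylor_coeff h (Suc n) + c * a n" for n
    by (simp_all add: a_def)
  have "summable (\<lambda>n. (norm (a n))\<^sup>2)"
  proof (rule summable_contraction_forward[where r="norm c"
        and y="\<lambda>n. (norm (taylor_coeff h (Suc n)))\<^sup>2 / (1 - norm c)"])
    show "summable (\<lambda>n. (norm (taylor_coeff h (Suc n)))\<^sup>2 / (1 - norm c))"
      using hardy_summable[OF h]
      by (intro summable_divide) (simp add: summable_Suc_iff[of "\<lambda>n. (norm (taylor_coeff h n))\<^sup>2"])
    show "(norm (a (Suc n)))\<^sup>2
        \<le> (norm (taylor_coeff h (Suc n)))\<^sup>2 / (1 - norm c) + norm c * (norm (a n))\<^sup>2" for n
      using c norm_triangle_ineq[of "taylor_coeff h (Suc n)" "c * a n"]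
      by (intro square_convex_bound) (simp_all add: a norm_mult)
  qed (use c in auto)
  note k = hardy_of[OF this]
  have "(\<lambda>z. 1 * hardy_of a z + - c * hardy_shift (hardy_of a) z) = h"
    using hardy_lincomb[OF k(1) hardy_shift(1)[OF k(1)], of 1 "- c"] hardy_shift(2)[OF k(1)] k(2) h
    by (intro hardy_eqI) (auto simp: a split: nat.split)
  have "(1 - c * z) * hardy_of a z = h z" for z
    using fun_cong[OF \<open>_ = h\<close>, of z] by (simp add: hardy_shift_def algebra_simps)
  with k show ?thesis using that by blast
qed

lemma hardy_divide:
  assumes f: "f \<in> hardy2" and \<beta>: "norm \<beta> < 1"
  obtains g where "g \<in> hardy2"
    "f = (\<lambda>z. f \<beta> * hardy_monom 0 z + (hardy_shift g z - \<beta> * g z))"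
proof -
  let ?f = "taylor_coeff f"
  \<comment> \<open>These are the Taylor coefficients of (f(z) - f(\<beta>)) / (z -
    \<beta>).\<close>
  define a where "a n = (\<Sum>k. ?f (k + Suc n) * \<beta> ^ k)" for n
  obtain M where M: "\<And>n. norm (?f n) \<le> M"
    using square_summable_imp_bounded[OF hardy_summable[OF f]] by blast
  have geo: "(\<lambda>k. M * norm \<beta> ^ k) sums (M / (1 - norm \<beta>))"
    using sums_mult[OF geometric_sums[of "norm \<beta>"], of M] \<beta> by simp
  have le: "norm (?f (k + Suc n) * \<beta> ^ k) \<le> M * norm \<beta> ^ k" for k n
    using M by (simp add: norm_mult norm_power mult_right_mono)
  have summ: "summable (\<lambda>k. norm (?f (k + Suc n) * \<beta> ^ k))" for n
    by (rule summable_comparison_test'[OF sums_summable[OF geo]]) (use le in simp)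
  have bound: "norm (a n) \<le> M / (1 - norm \<beta>)" for n
  proof -
    have "norm (a n) \<le> (\<Sum>k. norm (?f (k + Suc n) * \<beta> ^ k))"
      unfolding a_def by (rule summable_norm[OF summ])
    also have "\<dots> \<le> M / (1 - norm \<beta>)"
      using le sums_unique[OF geo] suminf_le[OF _ summ sums_summable[OF geo]] by simp
    finally show ?thesis .
  qed
  have a: "?f (Suc n) = a n - \<beta> * a (Suc n)" for n
  proof -
    have "a n = ?f (Suc n) + (\<Sum>k. ?f (Suc k + Suc n) * \<beta> ^ Suc k)"
      using suminf_split_head[OF summable_norm_cancel[OF summ[of n]]] by (simp add: a_def)
    also have "(\<Sum>k. ?f (Suc k + Suc n) * \<beta> ^ Suc k) = (\<Sum>k. \<beta> * (?f (k + Suc (Suc n)) * \<beta> ^ k))"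
      by (simp add: mult_ac)
    also have "\<dots> = \<beta> * a (Suc n)"
      unfolding a_def by (rule suminf_mult[OF summable_norm_cancel[OF summ]])
    finally show ?thesis by simp
  qed
  have f\<beta>: "f \<beta> = ?f 0 + \<beta> * a 0"
  proof -
    have "f \<beta> = (\<Sum>k. ?f k * \<beta> ^ k)"
      using hardy_sums[OF f \<beta>] by (rule sums_unique)
    also have "\<dots> = ?f 0 + (\<Sum>k. ?f (Suc k) * \<beta> ^ Suc k)"
      using suminf_split_head[OF sums_summable[OF hardy_sums[OF f \<beta>]]] by simp
    also have "(\<Sum>k. ?f (Suc k) * \<beta> ^ Suc k) = (\<Sum>k. \<beta> * (?f (k + Suc 0) * \<beta> ^ k))"
      by (simp add: mult_ac)
    also have "\<dots> = \<beta> * a 0"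
      unfolding a_def by (rule suminf_mult[OF summable_norm_cancel[OF summ]])
    finally show ?thesis .
  qed
  \<comment> \<open>The recursion \<open>a\<close>, solved for \<open>a n\<close>, contracts from
    index n + 1 back to n with ratio \<beta>; the geometric series bound on \<open>a\<close>
    supplies the uniform bound that this direction requires.\<close>
  have "summable (\<lambda>n. (norm (a n))\<^sup>2)"
  proof (rule summable_contraction_backward[where r="norm \<beta>" and M="(M / (1 - norm \<beta>))\<^sup>2"
        and y="\<lambda>n. (norm (?f (Suc n)))\<^sup>2 / (1 - norm \<beta>)"])
    show "summable (\<lambda>n. (norm (?f (Suc n)))\<^sup>2 / (1 - norm \<beta>))"
      using hardy_summable[OF f]
      by (intro summable_divide) (simp add: summable_Suc_iff[of "\<lambda>n. (norm (taylor_coeff f n))\<^sup>2"])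
    show "(norm (a n))\<^sup>2 \<le> (norm (?f (Suc n)))\<^sup>2 / (1 - norm \<beta>) + norm \<beta> * (norm (a (Suc n)))\<^sup>2" for n
      using \<beta> norm_triangle_ineq[of "?f (Suc n)" "\<beta> * a (Suc n)"]
      by (intro square_convex_bound) (simp_all add: a norm_mult)
    show "(norm (a n))\<^sup>2 \<le> (M / (1 - norm \<beta>))\<^sup>2" for n
      using bound by (intro power_mono) auto
  qed (use \<beta> in auto)
  note g = hardy_of[OF this]
  have d: "(\<lambda>z. 1 * hardy_shift (hardy_of a) z + - \<beta> * hardy_of a z) \<in> hardy2"
    "taylor_coeff (\<lambda>z. 1 * hardy_shift (hardy_of a) z + - \<beta> * hardy_of a z)
      = (\<lambda>n. 1 * case_nat 0 a n + - \<beta> * a n)"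
    using hardy_lincomb[OF hardy_shift(1)[OF g(1)] g(1), of 1 "- \<beta>"] hardy_shift(2)[OF g(1)] g(2)
    by simp_all
  \<comment> \<open>Coefficients are compared: index 0 is the formula for \<open>f \<beta>\<close>,
    and the positive indices are the recursion \<open>a\<close>.\<close>
  have "f = (\<lambda>z. f \<beta> * hardy_monom 0 z + 1 * (1 * hardy_shift (hardy_of a) z + - \<beta> * hardy_of a z))"
    using hardy_lincomb[OF hardy_monom(1) d(1), of "f \<beta>" 0 1] f f\<beta> a d(2) hardy_monom(2)[of 0]
    by (intro hardy_eqI) (auto split: nat.split)
  with g that[of "hardy_of a"] show ?thesis by simp
qed

section \<open>Blaschke factors and vanishing at a point\<close>

lemma one_minus_cnj_mult_neq_0:
  assumes "norm \<alpha> < 1" "norm z < 1"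
  shows "1 - cnj \<alpha> * z \<noteq> 0"
proof
  assume "1 - cnj \<alpha> * z = 0"
  then have "norm \<alpha> * norm z = 1"
    by (metis complex_mod_cnj eq_iff_diff_eq_0 norm_mult norm_one)
  then show False
    using assms mult_strict_mono'[of "norm \<alpha>" 1 "norm z" 1] by simp
qed

text \<open>From left to right, \<open>hardy_resolvent\<close> absorbs the denominator and the
  numerator gives the zero. Conversely, \<open>hardy_divide\<close> writes f as (z - \<alpha>) g,
  and g is multiplied by the denominator to complete the Blaschke factor.\<close>

lemma blaschke_image:
  assumes \<alpha>: "norm \<alpha> < 1"
  shows "(\<lambda>h z. blaschke_factor \<alpha> z * h z) ` hardy2 = {f \<in> hardy2. f \<alpha> = 0}"
proof (intro equalityI subsetI)
  fix f assume "f \<in> (\<lambda>h z. blaschke_factor \<alpha> z * h z) ` hardy2"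
  then obtain h where h: "h \<in> hardy2" and f: "f = (\<lambda>z. blaschke_factor \<alpha> z * h z)"
    by auto
  obtain k where k: "k \<in> hardy2" "\<And>z. (1 - cnj \<alpha> * z) * k z = h z"
    using hardy_resolvent[OF h, of "cnj \<alpha>"] \<alpha> by auto
  have "f = (\<lambda>z. 1 * hardy_shift k z + - \<alpha> * k z)"
  proof
    fix z
    show "f z = 1 * hardy_shift k z + - \<alpha> * k z"
    proof (cases "norm z < 1")
      case True
      then have "h z / (1 - cnj \<alpha> * z) = k z"
        using one_minus_cnj_mult_neq_0[OF \<alpha>, of z] k(2)[of z] by (simp add: field_simps)
      moreover have "f z = (z - \<alpha>) * (h z / (1 - cnj \<alpha> * z))"
        by (simp add: f blaschke_factor_def)
      ultimately show ?thesis
        by (simp add: hardy_shift_def left_diff_distrib)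
    next
      case False
      then show ?thesis
        using h k(1) by (simp add: f hardy_outside hardy_shift_def)
    qed
  qed
  then have "f \<in> hardy2"
    using hardy_lincomb(1)[OF hardy_shift(1)[OF k(1)] k(1), of 1 "- \<alpha>"] by simp
  then show "f \<in> {f \<in> hardy2. f \<alpha> = 0}"
    by (simp add: f blaschke_factor_def)
next
  fix f assume f: "f \<in> {f \<in> hardy2. f \<alpha> = 0}"
  then obtain g where g: "g \<in> hardy2" "f = (\<lambda>z. hardy_shift g z - \<alpha> * g z)"
    using hardy_divide[of f \<alpha>] \<alpha> by auto
  let ?h = "\<lambda>z. 1 * g z + - cnj \<alpha> * hardy_shift g z"
  have "f = (\<lambda>z. blaschke_factor \<alpha> z * ?h z)"
  proof
    fix z
    show "f z = blaschke_factor \<alpha> z * ?h z"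
    proof (cases "norm z < 1")
      case True
      then show ?thesis
        using one_minus_cnj_mult_neq_0[OF \<alpha> True]
        by (simp add: g(2) blaschke_factor_def hardy_shift_def field_simps)
    next
      case False
      then show ?thesis
        using g(1) by (simp add: g(2) hardy_outside hardy_shift_def)
    qed
  qed
  moreover have "?h \<in> hardy2"
    by (rule hardy_lincomb(1)[OF g(1) hardy_shift(1)[OF g(1)]])
  ultimately show "f \<in> (\<lambda>h z. blaschke_factor \<alpha> z * h z) ` hardy2"
    by (rule image_eqI)
qed

lemma blaschke_hardy2:
  "norm \<alpha> < 1 \<Longrightarrow> h \<in> hardy2 \<Longrightarrow> (\<lambda>z. blaschke_factor \<alpha> z * h z) \<in> hardy2"
  using blaschke_image[of \<alpha>] by blast

subsection \<open>Shift-invariant kernels\<close>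

definition hardy_linear :: "((complex \<Rightarrow> complex) \<Rightarrow> complex) \<Rightarrow> bool" where
  "hardy_linear L \<longleftrightarrow>
     (\<forall>f\<in>hardy2. \<forall>g\<in>hardy2. \<forall>a b. L (\<lambda>z. a * f z + b * g z) = a * L f + b * L g)"

lemma hardy_linearD:
  "hardy_linear L \<Longrightarrow> f \<in> hardy2 \<Longrightarrow> g \<in> hardy2 \<Longrightarrow> L (\<lambda>z. a * f z + b * g z) = a * L f + b * L g"
  by (simp add: hardy_linear_def)

lemma hardy_linear_shift:
  assumes "hardy_linear L"
  shows "hardy_linear (\<lambda>f. L (hardy_shift f))"
  unfolding hardy_linear_def
proof (intro ballI allI)
  fix f g a b assume "f \<in> hardy2" "g \<in> hardy2"
  then have "L (\<lambda>z. a * hardy_shift f z + b * hardy_shift g z)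
      = a * L (hardy_shift f) + b * L (hardy_shift g)"
    by (intro hardy_linearD[OF assms] hardy_shift)
  then show "L (hardy_shift (\<lambda>z. a * f z + b * g z)) = a * L (hardy_shift f) + b * L (hardy_shift g)"
    by (simp add: hardy_shift_def algebra_simps)
qed

text \<open>If \<open>L e\<close> is nonzero, then f - (L f / L e) e lies in the kernel of
  \<open>L\<close>, hence in that of \<open>M\<close>. If \<open>L\<close> vanishes on the whole
  space, so does \<open>M\<close>, and \<open>c = 0\<close> works.\<close>

lemma kernel_subset_imp_multiple:
  assumes L: "hardy_linear L" and M: "hardy_linear M"
    and ker: "\<And>f. f \<in> hardy2 \<Longrightarrow> L f = 0 \<Longrightarrow> M f = 0"
  obtains c where "\<And>f. f \<in> hardy2 \<Longrightarrow> M f = c * L f"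
proof (cases "\<exists>e\<in>hardy2. L e \<noteq> 0")
  case True
  then obtain e where e: "e \<in> hardy2" "L e \<noteq> 0" by blast
  have "M f = (M e / L e) * L f" if f: "f \<in> hardy2" for f
  proof -
    have "L (\<lambda>z. 1 * f z + - (L f / L e) * e z) = 0"
      unfolding hardy_linearD[OF L f e(1)] using e by simp
    then have "M (\<lambda>z. 1 * f z + - (L f / L e) * e z) = 0"
      by (intro ker hardy_lincomb(1) f e)
    then show ?thesis
      unfolding hardy_linearD[OF M f e(1)] by (simp add: mult.commute)
  qed
  then show ?thesis by (rule that)
next
  case False
  then show ?thesis using ker that[of 0] by simp
qed

definition hardy_independent ::
  "((complex \<Rightarrow> complex) \<Rightarrow> complex) \<Rightarrow> ((complex \<Rightarrow> complex) \<Rightarrow> complex) \<Rightarrow> bool" where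
  "hardy_independent L M \<longleftrightarrow> (\<forall>a b. (\<forall>f\<in>hardy2. a * L f + b * M f = 0) \<longrightarrow> a = 0 \<and> b = 0)"

lemma hardy_independent_commute: "hardy_independent L M \<Longrightarrow> hardy_independent M L"
  unfolding hardy_independent_def by (metis add.commute)

lemma hardy_independent_obtain:
  assumes "hardy_linear L" "hardy_linear M" "hardy_independent L M"
  obtains e where "e \<in> hardy2" "L e = 0" "M e \<noteq> 0"
proof (rule ccontr)
  assume "\<not> thesis"
  with that have ker: "\<And>e. e \<in> hardy2 \<Longrightarrow> L e = 0 \<Longrightarrow> M e = 0" by blast
  obtain c where c: "\<And>f. f \<in> hardy2 \<Longrightarrow> M f = c * L f"
    using kernel_subset_imp_multiple[OF assms(1,2) ker] by blast
  have "\<forall>f\<in>hardy2. c * L f + - 1 * M f = 0" by (simp add: c)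
  then show False
    using assms(3) unfolding hardy_independent_def by (metis neg_equal_0_iff_equal zero_neq_one)
qed

text \<open>Independence provides \<open>e1\<close> and \<open>e2\<close>, dual to \<open>L1\<close>
  and \<open>L2\<close> up to scaling. Subtracting suitable multiples of both moves f into the
  common kernel, where \<open>M\<close> vanishes.\<close>

lemma kernel_Int_subset_imp_lincomb:
  assumes L1: "hardy_linear L1" and L2: "hardy_linear L2" and M: "hardy_linear M"
    and ind: "hardy_independent L1 L2"
    and ker: "\<And>f. f \<in> hardy2 \<Longrightarrow> L1 f = 0 \<Longrightarrow> L2 f = 0 \<Longrightarrow> M f = 0"
  obtains a b where "\<And>f. f \<in> hardy2 \<Longrightarrow> M f = a * L1 f + b * L2 f"
proof -
  obtain e2 where e2: "e2 \<in> hardy2" "L1 e2 = 0" "L2 e2 \<noteq> 0"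
    using hardy_independent_obtain[OF L1 L2 ind] .
  obtain e1 where e1: "e1 \<in> hardy2" "L2 e1 = 0" "L1 e1 \<noteq> 0"
    using hardy_independent_obtain[OF L2 L1 hardy_independent_commute[OF ind]] .
  have "M f = M e1 / L1 e1 * L1 f + M e2 / L2 e2 * L2 f" if f: "f \<in> hardy2" for f
  proof -
    let ?g = "\<lambda>z. 1 * f z + - (L1 f / L1 e1) * e1 z"
    have g: "?g \<in> hardy2" by (rule hardy_lincomb(1)[OF f e1(1)])
    let ?k = "\<lambda>z. 1 * ?g z + - (L2 f / L2 e2) * e2 z"
    have "L1 ?k = 0"
      unfolding hardy_linearD[OF L1 g e2(1)] hardy_linearD[OF L1 f e1(1)] using e1 e2 by simp
    moreover have "L2 ?k = 0"
      unfolding hardy_linearD[OF L2 g e2(1)] hardy_linearD[OF L2 f e1(1)] using e1 e2 by simp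
    ultimately have "M ?k = 0"
      by (intro ker hardy_lincomb(1)[OF g e2(1)])
    then show ?thesis
      unfolding hardy_linearD[OF M g e2(1)] hardy_linearD[OF M f e1(1)] by (simp add: algebra_simps)
  qed
  then show ?thesis by (rule that)
qed

text \<open>Stands in for continuity of \<open>L\<close>: it forces eigenvalues of the shift into
  the open disc, and it survives linear combinations and composition with multiplication by a
  Blaschke factor.\<close>

definition shift_null :: "((complex \<Rightarrow> complex) \<Rightarrow> complex) \<Rightarrow> bool" where
  "shift_null L \<longleftrightarrow> (\<forall>f\<in>hardy2. (\<lambda>n. L ((hardy_shift ^^ n) f)) \<longlonglongrightarrow> 0)"

text \<open>Such an \<open>L\<close> is a multiple of evaluation at \<beta>, because it annihilates
  (z - \<beta>) g for every g.\<close>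

lemma shift_eigenfunctional:
  assumes L: "hardy_linear L" "shift_null L"
    and eigen: "\<And>f. f \<in> hardy2 \<Longrightarrow> L (hardy_shift f) = \<beta> * L f"
    and nz: "f0 \<in> hardy2" "L f0 \<noteq> 0"
  shows "norm \<beta> < 1" and "f \<in> hardy2 \<Longrightarrow> L f = 0 \<longleftrightarrow> f \<beta> = 0"
proof -
  have "L ((hardy_shift ^^ n) f0) = \<beta> ^ n * L f0" for n
    by (induction n) (simp_all add: eigen hardy_shift_funpow nz)
  moreover have "(\<lambda>n. L ((hardy_shift ^^ n) f0)) \<longlonglongrightarrow> 0"
    using L(2) nz(1) unfolding shift_null_def by blast
  ultimately have "(\<lambda>n. \<beta> ^ n) \<longlonglongrightarrow> 0"
    using nz(2) by simp
  then show \<beta>: "norm \<beta> < 1"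
    using LIMSEQ_D[of _ 0 1] one_le_power[of "norm \<beta>"]
    by (metis diff_zero le_refl norm_power not_le zero_less_one)
  have eval: "L f = f \<beta> * L (hardy_monom 0)" if f: "f \<in> hardy2" for f
  proof -
    obtain g where g: "g \<in> hardy2"
      and fg: "f = (\<lambda>z. f \<beta> * hardy_monom 0 z + (hardy_shift g z - \<beta> * g z))"
      using hardy_divide[OF f \<beta>] .
    let ?d = "\<lambda>z. 1 * hardy_shift g z + - \<beta> * g z"
    have d: "?d \<in> hardy2"
      by (rule hardy_lincomb(1)[OF hardy_shift(1)[OF g] g])
    have "L ?d = 0"
      unfolding hardy_linearD[OF L(1) hardy_shift(1)[OF g] g] eigen[OF g] by simp
    have "f = (\<lambda>z. f \<beta> * hardy_monom 0 z + 1 * ?d z)"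
      using fg by simp
    from arg_cong[OF this, of L] have "L f = f \<beta> * L (hardy_monom 0) + 1 * L ?d"
      unfolding hardy_linearD[OF L(1) hardy_monom(1) d] .
    then show ?thesis
      by (simp only: \<open>L ?d = 0\<close>) simp
  qed
  from eval[OF nz(1)] nz(2) have "L (hardy_monom 0) \<noteq> 0" by auto
  then show "f \<in> hardy2 \<Longrightarrow> L f = 0 \<longleftrightarrow> f \<beta> = 0"
    by (simp add: eval)
qed

text \<open>Invariance says that the kernel of \<open>L\<close> lies in that of f \<mapsto> L (S f),
  so the latter functional is a multiple of \<open>L\<close>.\<close>

lemma shift_invariant_kernel:
  assumes L: "hardy_linear L" "shift_null L"
    and inv: "\<And>f. f \<in> hardy2 \<Longrightarrow> L f = 0 \<Longrightarrow> L (hardy_shift f) = 0"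
    and nz: "f0 \<in> hardy2" "L f0 \<noteq> 0"
  obtains \<alpha> where "norm \<alpha> < 1"
    "{f \<in> hardy2. L f = 0} = (\<lambda>h z. blaschke_factor \<alpha> z * h z) ` hardy2"
proof -
  obtain \<beta> where eigen: "\<And>f. f \<in> hardy2 \<Longrightarrow> L (hardy_shift f) = \<beta> * L f"
    using kernel_subset_imp_multiple[OF L(1) hardy_linear_shift[OF L(1)] inv] by blast
  note e = shift_eigenfunctional[OF L eigen nz]
  show ?thesis
    using e that[of \<beta>] by (auto simp: blaschke_image)
qed

section \<open>Dividing by a Blaschke factor, and kernels of codimension two\<close>

lemma hardy_linear_blaschke:
  assumes L: "hardy_linear L" and \<alpha>: "norm \<alpha> < 1"
  shows "hardy_linear (\<lambda>h. L (\<lambda>z. blaschke_factor \<alpha> z * h z))"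
  unfolding hardy_linear_def
proof (intro ballI allI)
  fix f g a b assume "f \<in> hardy2" "g \<in> hardy2"
  then show "L (\<lambda>z. blaschke_factor \<alpha> z * (a * f z + b * g z)) =
      a * L (\<lambda>z. blaschke_factor \<alpha> z * f z) + b * L (\<lambda>z. blaschke_factor \<alpha> z * g z)"
    using hardy_linearD[OF L blaschke_hardy2[OF \<alpha>] blaschke_hardy2[OF \<alpha>], of f g a b]
    by (simp add: algebra_simps)
qed

lemma hardy_shift_mult: "hardy_shift (\<lambda>z. b z * h z) = (\<lambda>z. b z * hardy_shift h z)"
  by (simp add: hardy_shift_def mult.left_commute)

lemma shift_null_blaschke:
  assumes L: "shift_null L" and \<alpha>: "norm \<alpha> < 1"
  shows "shift_null (\<lambda>h. L (\<lambda>z. blaschke_factor \<alpha> z * h z))"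
proof -
  have "(\<lambda>z. blaschke_factor \<alpha> z * (hardy_shift ^^ n) h z)
      = (hardy_shift ^^ n) (\<lambda>z. blaschke_factor \<alpha> z * h z)" for n h
  proof (induction n)
    case (Suc n)
    have "(\<lambda>z. blaschke_factor \<alpha> z * (hardy_shift ^^ Suc n) h z)
        = hardy_shift (\<lambda>z. blaschke_factor \<alpha> z * (hardy_shift ^^ n) h z)"
      by (simp add: hardy_shift_mult)
    then show ?case
      by (simp only: Suc funpow.simps o_apply)
  qed simp
  then show ?thesis
    using L blaschke_hardy2[OF \<alpha>] by (simp add: shift_null_def)
qed

text \<open>The kernel of \<open>L\<close> is B H^2 with B the Blaschke factor at \<alpha>. Pulled
  back along multiplication by B, which commutes with the shift, \<open>M\<close> becomes a
  functional on H^2 with shift-invariant kernel, and the codimension-one case applies.\<close>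

lemma shift_invariant_kernel_Int_eigen:
  assumes L: "hardy_linear L" "shift_null L" and M: "hardy_linear M" "shift_null M"
    and ind: "hardy_independent L M"
    and eigen: "\<And>f. f \<in> hardy2 \<Longrightarrow> L (hardy_shift f) = \<alpha> * L f"
    and inv: "\<And>f. f \<in> hardy2 \<Longrightarrow> L f = 0 \<Longrightarrow> M f = 0 \<Longrightarrow> M (hardy_shift f) = 0"
  obtains \<beta> where "norm \<alpha> < 1" "norm \<beta> < 1"
    "{f \<in> hardy2. L f = 0 \<and> M f = 0} =
      (\<lambda>h z. blaschke_factor \<alpha> z * blaschke_factor \<beta> z * h z) ` hardy2"
proof -
  obtain e where e: "e \<in> hardy2" "M e = 0" "L e \<noteq> 0"
    using hardy_independent_obtain[OF M(1) L(1) hardy_independent_commute[OF ind]] .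
  note ev = shift_eigenfunctional[OF L eigen e(1,3)]
  note \<alpha> = ev(1)
  have kerL: "{f \<in> hardy2. L f = 0} = (\<lambda>h z. blaschke_factor \<alpha> z * h z) ` hardy2"
    using ev by (auto simp: blaschke_image)
  let ?M = "\<lambda>h. M (\<lambda>z. blaschke_factor \<alpha> z * h z)"
  \<comment> \<open>This witness shows that the pulled-back functional is not zero.\<close>
  obtain f0 where f0: "f0 \<in> hardy2" "L f0 = 0" "M f0 \<noteq> 0"
    using hardy_independent_obtain[OF L(1) M(1) ind] .
  then have "f0 \<in> (\<lambda>h z. blaschke_factor \<alpha> z * h z) ` hardy2"
    using kerL by blast
  then obtain h0 where h0: "h0 \<in> hardy2" "?M h0 \<noteq> 0"
    using f0(3) by blast
  have inv': "?M (hardy_shift h) = 0" if "h \<in> hardy2" "?M h = 0" for h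
  proof -
    have "(\<lambda>z. blaschke_factor \<alpha> z * h z) \<in> {f \<in> hardy2. L f = 0}"
      using that(1) unfolding kerL by blast
    then have "M (hardy_shift (\<lambda>z. blaschke_factor \<alpha> z * h z)) = 0"
      using inv that(2) by blast
    then show ?thesis
      by (simp only: hardy_shift_mult)
  qed
  obtain \<beta> where \<beta>: "norm \<beta> < 1"
    and kerM: "{h \<in> hardy2. ?M h = 0} = (\<lambda>h z. blaschke_factor \<beta> z * h z) ` hardy2"
    using shift_invariant_kernel[of ?M, OF hardy_linear_blaschke[OF M(1) \<alpha>]
        shift_null_blaschke[OF M(2) \<alpha>] inv' h0] .
  have "{f \<in> hardy2. L f = 0 \<and> M f = 0} = {f \<in> {f \<in> hardy2. L f = 0}. M f = 0}"
    by auto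
  also have "\<dots> = (\<lambda>h z. blaschke_factor \<alpha> z * h z) ` {h \<in> hardy2. ?M h = 0}"
    unfolding kerL by (rule Compr_image_eq)
  also have "\<dots> = (\<lambda>h z. blaschke_factor \<alpha> z * blaschke_factor \<beta> z * h z) ` hardy2"
    unfolding kerM by (simp only: image_image mult.assoc)
  finally show ?thesis
    using that \<alpha> \<beta> by blast
qed

lemma complex_quadratic_root:
  fixes a b c :: complex
  assumes "a \<noteq> 0"
  obtains t where "a * t\<^sup>2 + b * t + c = 0"
proof
  let ?s = "csqrt (b\<^sup>2 - 4 * a * c)"
  have "a * ((?s - b) / (2 * a))\<^sup>2 + b * ((?s - b) / (2 * a)) + c
      = (?s\<^sup>2 - (b\<^sup>2 - 4 * a * c)) / (4 * a)"
    using assms by (simp add: field_simps power2_eq_square del: power2_csqrt)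
  then show "a * ((?s - b) / (2 * a))\<^sup>2 + b * ((?s - b) / (2 * a)) + c = 0"
    by simp
qed

lemma hardy_linear_add_mult:
  assumes "hardy_linear L" "hardy_linear M"
  shows "hardy_linear (\<lambda>f. L f + t * M f)"
  unfolding hardy_linear_def
proof (intro ballI allI)
  fix f g a b assume fg: "f \<in> hardy2" "g \<in> hardy2"
  show "L (\<lambda>z. a * f z + b * g z) + t * M (\<lambda>z. a * f z + b * g z)
      = a * (L f + t * M f) + b * (L g + t * M g)"
    unfolding hardy_linearD[OF assms(1) fg] hardy_linearD[OF assms(2) fg]
    by (simp add: algebra_simps)
qed

lemma shift_null_add_mult:
  assumes "shift_null L" "shift_null M"
  shows "shift_null (\<lambda>f. L f + t * M f)"
  unfolding shift_null_def
proof
  fix f assume "f \<in> hardy2"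
  then have "(\<lambda>n. L ((hardy_shift ^^ n) f) + t * M ((hardy_shift ^^ n) f)) \<longlonglongrightarrow> 0 + t * 0"
    using assms by (intro tendsto_add tendsto_mult_left) (auto simp: shift_null_def)
  then show "(\<lambda>n. L ((hardy_shift ^^ n) f) + t * M ((hardy_shift ^^ n) f)) \<longlonglongrightarrow> 0"
    by simp
qed

text \<open>Passing from \<open>L\<close> to \<open>L + t M\<close> is an invertible change of basis
  in the plane spanned by \<open>L\<close> and \<open>M\<close>.\<close>

lemma hardy_independent_add_mult:
  assumes "hardy_independent L M"
  shows "hardy_independent (\<lambda>f. L f + t * M f) M"
  unfolding hardy_independent_def
proof (intro allI impI)
  fix a b assume "\<forall>f\<in>hardy2. a * (L f + t * M f) + b * M f = 0"
  then have "\<forall>f\<in>hardy2. a * L f + (a * t + b) * M f = 0"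
    by (simp add: algebra_simps)
  then have "a = 0 \<and> a * t + b = 0"
    using assms unfolding hardy_independent_def by blast
  then show "a = 0 \<and> b = 0" by auto
qed

lemma shift_invariant_kernel_Int:
  assumes L: "hardy_linear L" "shift_null L" and M: "hardy_linear M" "shift_null M"
    and ind: "hardy_independent L M"
    and inv: "\<And>f. f \<in> hardy2 \<Longrightarrow> L f = 0 \<Longrightarrow> M f = 0 \<Longrightarrow>
      L (hardy_shift f) = 0 \<and> M (hardy_shift f) = 0"
  obtains \<alpha> \<beta> where "norm \<alpha> < 1" "norm \<beta> < 1"
    "{f \<in> hardy2. L f = 0 \<and> M f = 0} =
      (\<lambda>h z. blaschke_factor \<alpha> z * blaschke_factor \<beta> z * h z) ` hardy2"
proof -
  obtain a b where ab: "\<And>f. f \<in> hardy2 \<Longrightarrow> L (hardy_shift f) = a * L f + b * M f"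
    using kernel_Int_subset_imp_lincomb[OF L(1) M(1) hardy_linear_shift[OF L(1)] ind] inv by blast
  obtain c d where cd: "\<And>f. f \<in> hardy2 \<Longrightarrow> M (hardy_shift f) = c * L f + d * M f"
    using kernel_Int_subset_imp_lincomb[OF L(1) M(1) hardy_linear_shift[OF M(1)] ind] inv by blast
  show ?thesis
  proof (cases "c = 0")
    \<comment> \<open>Now \<open>M\<close> itself is an eigenvector, and the roles of
      \<open>L\<close> and \<open>M\<close> are exchanged.\<close>
    case True
    then have eigen: "\<And>f. f \<in> hardy2 \<Longrightarrow> M (hardy_shift f) = d * M f"
      by (simp add: cd)
    obtain \<beta> where "norm d < 1" "norm \<beta> < 1"
      "{f \<in> hardy2. M f = 0 \<and> L f = 0} =
        (\<lambda>h z. blaschke_factor d z * blaschke_factor \<beta> z * h z) ` hardy2"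
      using shift_invariant_kernel_Int_eigen[OF M L hardy_independent_commute[OF ind] eigen] inv
      by blast
    then show ?thesis
      using that[of d \<beta>] by (simp add: conj_commute)
  next
    case False
    \<comment> \<open>On the basis \<open>L\<close>, \<open>M\<close>, composition with the shift
      sends L + t M to (a + t c) L + (b + t d) M. This is a multiple of L + t M exactly when b + t d
      = (a + t c) t, which is the quadratic equation for t.\<close>
    obtain t where t: "c * t\<^sup>2 + (a - d) * t + - b = 0"
      using complex_quadratic_root[OF False] .
    let ?L = "\<lambda>f. L f + t * M f"
    have eigen: "?L (hardy_shift f) = (a + t * c) * ?L f" if f: "f \<in> hardy2" for f
    proof -
      have "b + t * d = (a + t * c) * t"
        using t by (simp add: algebra_simps power2_eq_square)
      then have "(b + t * d) * M f = (a + t * c) * t * M f"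
        by simp
      then show ?thesis
        unfolding ab[OF f] cd[OF f] by (simp add: algebra_simps)
    qed
    have inv': "M (hardy_shift f) = 0" if "f \<in> hardy2" "?L f = 0" "M f = 0" for f
      using inv that by auto
    obtain \<beta> where *: "norm (a + t * c) < 1" "norm \<beta> < 1"
      "{f \<in> hardy2. ?L f = 0 \<and> M f = 0} =
        (\<lambda>h z. blaschke_factor (a + t * c) z * blaschke_factor \<beta> z * h z) ` hardy2"
      using shift_invariant_kernel_Int_eigen[OF hardy_linear_add_mult[OF L(1) M(1)]
          shift_null_add_mult[OF L(2) M(2)] M hardy_independent_add_mult[OF ind] eigen inv'] .
    have "{f \<in> hardy2. ?L f = 0 \<and> M f = 0} = {f \<in> hardy2. L f = 0 \<and> M f = 0}"
      by auto
    then show ?thesis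
      using that[OF *(1,2)] *(3) by simp
  qed
qed

subsection \<open>Rank-one perturbations of the shift\<close>

lemma hardy_linear_inner: "v \<in> hardy2 \<Longrightarrow> hardy_linear (\<lambda>f. hardy_inner f v)"
  by (simp add: hardy_linear_def hardy_inner_lincomb_left)

lemma shift_null_inner: "v \<in> hardy2 \<Longrightarrow> shift_null (\<lambda>f. hardy_inner f v)"
  by (simp add: shift_null_def hardy_inner_shift_funpow_tendsto_0)

lemma hardy_inner_zero: "hardy_inner f (\<lambda>z. 0) = 0"
  by (simp add: hardy_inner_def taylor_coeff_def)

text \<open>This is the adjoint S* of the shift, as \<open>hardy_inner_shift\<close>
  confirms.\<close>

definition backward_shift :: hardy_op where
  "backward_shift g = hardy_of (\<lambda>n. taylor_coeff g (Suc n))"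

lemma backward_shift:
  assumes "g \<in> hardy2"
  shows "backward_shift g \<in> hardy2" "taylor_coeff (backward_shift g) = (\<lambda>n. taylor_coeff g (Suc n))"
proof -
  have "summable (\<lambda>n. (norm (taylor_coeff g (Suc n)))\<^sup>2)"
    using hardy_summable[OF assms] by (subst summable_Suc_iff)
  then show "backward_shift g \<in> hardy2" "taylor_coeff (backward_shift g) = (\<lambda>n. taylor_coeff g (Suc n))"
    unfolding backward_shift_def by (rule hardy_of)+
qed

lemma hardy_inner_shift:
  assumes "f \<in> hardy2" "g \<in> hardy2"
  shows "hardy_inner (hardy_shift f) g = hardy_inner f (backward_shift g)"
proof -
  have "(\<lambda>n. taylor_coeff (hardy_shift f) (Suc n) * cnj (taylor_coeff g (Suc n)))
      sums hardy_inner (hardy_shift f) g"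
    using hardy_inner_sums[OF hardy_shift(1)[OF assms(1)] assms(2)]
    by (subst sums_Suc_iff) (simp add: hardy_shift(2)[OF assms(1)])
  then show ?thesis
    by (simp add: sums_iff hardy_inner_def hardy_shift(2)[OF assms(1)] backward_shift(2)[OF assms(2)])
qed

section \<open>The adjoint of the perturbed shift\<close>

definition shift_perturb :: "(complex \<Rightarrow> complex) \<Rightarrow> (complex \<Rightarrow> complex) \<Rightarrow> hardy_op" where
  "shift_perturb u v = (\<lambda>f z. hardy_shift f z + rank_one u v f z)"

lemma shift_perturb_eq: "shift_perturb u v f = (\<lambda>z. 1 * hardy_shift f z + hardy_inner f v * u z)"
  by (simp add: shift_perturb_def rank_one_def)

lemma shift_perturb_hardy2:
  "u \<in> hardy2 \<Longrightarrow> f \<in> hardy2 \<Longrightarrow> shift_perturb u v f \<in> hardy2"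
  unfolding shift_perturb_eq by (intro hardy_lincomb hardy_shift)

text \<open>Exhibiting \<open>h\<close> settles existence in the definite description, and
  \<open>hardy_inner_eqD\<close> gives uniqueness.\<close>

lemma adjoint_eqI:
  assumes "h \<in> hardy2" "\<And>f. f \<in> hardy2 \<Longrightarrow> hardy_inner (A f) g = hardy_inner f h"
  shows "hardy_adjoint A g = h"
  unfolding hardy_adjoint_def
proof (rule the_equality)
  fix h' assume "h' \<in> hardy2 \<and> (\<forall>f\<in>hardy2. hardy_inner (A f) g = hardy_inner f h')"
  then show "h' = h"
    using assms by (intro hardy_inner_eqD) auto
qed (use assms in blast)

lemma adjoint_shift_perturb:
  assumes u: "u \<in> hardy2" and v: "v \<in> hardy2" and g: "g \<in> hardy2"
  defines "h \<equiv> \<lambda>z. 1 * backward_shift g z + hardy_inner g u * v z"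
  shows "h \<in> hardy2" "hardy_adjoint (shift_perturb u v) g = h"
    and "f \<in> hardy2 \<Longrightarrow> hardy_inner (shift_perturb u v f) g = hardy_inner f h"
proof -
  show h: "h \<in> hardy2"
    unfolding h_def by (intro hardy_lincomb backward_shift v g)
  show inner: "hardy_inner (shift_perturb u v f) g = hardy_inner f h" if f: "f \<in> hardy2" for f
    unfolding shift_perturb_eq h_def hardy_inner_lincomb_left[OF hardy_shift(1)[OF f] u g]
      hardy_inner_lincomb_right[OF backward_shift(1)[OF g] v f]
    using hardy_inner_shift[OF f g] hardy_inner_cnj[OF g u] by simp
  show "hardy_adjoint (shift_perturb u v) g = h"
    by (rule adjoint_eqI[OF h inner])
qed

text \<open>The formula T* g = S* g + \<langle>g, u\<rangle> v is applied to g = T f, using S* S f =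
  f, S* u = w and \<langle>S f, u\<rangle> = \<langle>f, w\<rangle>.\<close>

lemma adjoint_mult_shift_perturb:
  assumes u: "u \<in> hardy2" and v: "v \<in> hardy2" and f: "f \<in> hardy2"
  defines "w \<equiv> backward_shift u"
  shows "hardy_adjoint (shift_perturb u v) (shift_perturb u v f) =
    (\<lambda>z. f z + (hardy_inner f v * w z + (hardy_inner f w + hardy_inner f v * hardy_inner u u) * v z))"
proof -
  let ?g = "shift_perturb u v f"
  have g: "?g \<in> hardy2"
    by (rule shift_perturb_hardy2[OF u f])
  have w: "w \<in> hardy2" "taylor_coeff w = (\<lambda>n. taylor_coeff u (Suc n))"
    using backward_shift[OF u] by (simp_all add: w_def)
  have "backward_shift ?g = (\<lambda>z. 1 * f z + hardy_inner f v * w z)"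
  proof (rule hardy_eqI)
    show "(\<lambda>z. 1 * f z + hardy_inner f v * w z) \<in> hardy2"
      by (rule hardy_lincomb(1)[OF f w(1)])
    show "taylor_coeff (backward_shift ?g) n = taylor_coeff (\<lambda>z. 1 * f z + hardy_inner f v * w z) n" for n
      unfolding backward_shift(2)[OF g] hardy_lincomb(2)[OF f w(1)]
      unfolding shift_perturb_eq hardy_lincomb(2)[OF hardy_shift(1)[OF f] u] hardy_shift(2)[OF f] w(2)
      by simp
  qed (rule backward_shift(1)[OF g])
  moreover have "hardy_inner ?g u = hardy_inner f w + hardy_inner f v * hardy_inner u u"
    unfolding shift_perturb_eq hardy_inner_lincomb_left[OF hardy_shift(1)[OF f] u u]
    by (simp add: hardy_inner_shift[OF f u] w_def)
  ultimately show ?thesis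
    unfolding adjoint_shift_perturb(2)[OF u v g] by (simp add: add.assoc)
qed

lemma inner_functional_dependent:
  assumes "v \<in> hardy2" "w \<in> hardy2" "\<And>f. f \<in> hardy2 \<Longrightarrow> a * hardy_inner f v + b * hardy_inner f w = 0"
  shows "cnj a * v z + cnj b * w z = 0"
proof -
  \<comment> \<open>The zero function is written as a combination of \<open>v\<close> and
    \<open>w\<close> so that the rules for linear combinations apply to both sides.\<close>
  have "(\<lambda>z. cnj a * v z + cnj b * w z) = (\<lambda>z. 0 * v z + 0 * w z)"
  proof (rule hardy_inner_eqD)
    show "hardy_inner f (\<lambda>z. cnj a * v z + cnj b * w z) = hardy_inner f (\<lambda>z. 0 * v z + 0 * w z)"
      if "f \<in> hardy2" for f
      unfolding hardy_inner_lincomb_right[OF assms(1,2) that] using assms(3)[OF that] by simp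
  qed (rule hardy_lincomb(1)[OF assms(1,2)])+
  from fun_cong[OF this, of z] show ?thesis by simp
qed

theorem corollary1p3:
  fixes u v :: "complex \<Rightarrow> complex" and T :: hardy_op
  assumes u: "u \<in> hardy2" "u \<noteq> (\<lambda>z. 0)"
    and v: "v \<in> hardy2" "v \<noteq> (\<lambda>z. 0)"
    and T: "T = (\<lambda>f z. hardy_shift f z + rank_one u v f z)"
    and quasinormal: "quasinormal T"
    and not_isometry: "\<not> hardy_isometry T"
  shows "\<exists>\<theta>. ((\<exists>\<alpha>\<in>ball 0 1. \<theta> = blaschke_factor \<alpha>) \<or>
              (\<exists>\<alpha>\<in>ball 0 1. \<exists>\<beta>\<in>ball 0 1. \<theta> = (\<lambda>z. blaschke_factor \<alpha> z * blaschke_factor \<beta> z))) \<and>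
             hardy_kernel (\<lambda>f z. f z - hardy_adjoint T (T f) z) = (\<lambda>h z. \<theta> z * h z) ` hardy2"
proof -
  define w where "w = backward_shift u"
  define D where
    "D f = (\<lambda>z. hardy_inner f v * w z + (hardy_inner f w + hardy_inner f v * hardy_inner u u) * v z)" for f
  have w: "w \<in> hardy2"
    unfolding w_def by (rule backward_shift(1)[OF u(1)])
  have T': "T = shift_perturb u v"
    by (simp add: T shift_perturb_def)
  have TT: "hardy_adjoint T (T f) = (\<lambda>z. f z + D f z)" if "f \<in> hardy2" for f
    unfolding T' D_def w_def using adjoint_mult_shift_perturb[OF u(1) v(1) that] .
  have T_hardy2: "T f \<in> hardy2" if "f \<in> hardy2" for f
    unfolding T' using shift_perturb_hardy2[OF u(1) that] .
  have T_shift: "T f = hardy_shift f" if "hardy_inner f v = 0" for f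
    by (simp add: T' shift_perturb_eq that)
  \<comment> \<open>On H^2, \<open>D\<close> is T* T - I. If T* T f = f, quasinormality gives T* T
    (T f) = T (T* T f) = T f.\<close>
  have D_T: "D (T f) = (\<lambda>z. 0)" if f: "f \<in> hardy2" and D: "D f = (\<lambda>z. 0)" for f
  proof -
    have "hardy_adjoint T (T f) = f"
      using TT[OF f] D by simp
    then have "hardy_adjoint T (T (T f)) = T f"
      using quasinormal f unfolding quasinormal_def by metis
    with TT[OF T_hardy2[OF f]] have "T f z + D (T f) z = T f z" for z
      by metis
    then show ?thesis by (simp add: fun_eq_iff)
  qed
  have kernel: "hardy_kernel (\<lambda>f z. f z - hardy_adjoint T (T f) z) = {f \<in> hardy2. D f = (\<lambda>z. 0)}"
    by (auto simp: hardy_kernel_def TT fun_eq_iff)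
  \<comment> \<open>Were \<open>D\<close> zero on H^2, then \<langle>T f, T f\<rangle> = \<langle>f,
    T* T f\<rangle> = \<langle>f, f\<rangle> would make \<open>T\<close> an isometry.\<close>
  obtain f1 where f1: "f1 \<in> hardy2" "D f1 \<noteq> (\<lambda>z. 0)"
  proof (rule ccontr)
    assume "\<not> thesis"
    with that have D0: "\<And>f. f \<in> hardy2 \<Longrightarrow> D f = (\<lambda>z. 0)" by blast
    have "hardy_norm (T f) = hardy_norm f" if f: "f \<in> hardy2" for f
    proof -
      have "hardy_inner (T f) (T f) = hardy_inner f (hardy_adjoint T (T f))"
        using adjoint_shift_perturb(2,3)[OF u(1) v(1) shift_perturb_hardy2[OF u(1) f]] f
        by (simp add: T')
      then have "hardy_inner (T f) (T f) = hardy_inner f f"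
        by (simp add: TT[OF f] D0[OF f])
      then have "(hardy_norm (T f))\<^sup>2 = (hardy_norm f)\<^sup>2"
        unfolding hardy_inner_self[OF f] hardy_inner_self[OF T_hardy2[OF f]] of_real_eq_iff .
      moreover have "0 \<le> hardy_norm g" if "g \<in> hardy2" for g
        using suminf_nonneg[OF hardy_summable[OF that]] by (simp add: hardy_norm_def)
      ultimately show ?thesis
        using f T_hardy2 by (simp add: power2_eq_iff_nonneg)
    qed
    then show False
      using not_isometry by (simp add: hardy_isometry_def)
  qed
  let ?L = "\<lambda>f. hardy_inner f v" and ?M = "\<lambda>f. hardy_inner f w"
  show ?thesis
  proof (cases "hardy_independent ?L ?M")
    case True
    have D: "D f = (\<lambda>z. 0) \<longleftrightarrow> ?L f = 0 \<and> ?M f = 0" if f: "f \<in> hardy2" for f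
    proof
      assume D0: "D f = (\<lambda>z. 0)"
      let ?b = "hardy_inner f w + hardy_inner f v * hardy_inner u u"
      \<comment> \<open>Pairing an arbitrary g with \<open>D f = 0\<close> turns it into a relation
        between the two functionals, whose coefficients must vanish by independence.\<close>
      have "cnj ?b * hardy_inner g v + cnj (?L f) * hardy_inner g w = 0" if g: "g \<in> hardy2" for g
        using hardy_inner_lincomb_right[OF w v(1) g, of "?L f" ?b] D0
        by (simp add: D_def hardy_inner_zero add.commute)
      then have "cnj ?b = 0 \<and> cnj (?L f) = 0"
        using True unfolding hardy_independent_def by blast
      then show "?L f = 0 \<and> ?M f = 0" by auto
    qed (simp add: D_def)
    \<comment> \<open>Since \<open>?L f = 0\<close>, the image \<open>T f\<close> is the shift of f,
      and \<open>D_T\<close> keeps it in the kernel of \<open>D\<close>.\<close>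
    have inv: "?L (hardy_shift f) = 0 \<and> ?M (hardy_shift f) = 0"
      if "f \<in> hardy2" "?L f = 0" "?M f = 0" for f
      using that D D_T T_hardy2 T_shift by metis
    obtain \<alpha> \<beta> where ab: "norm \<alpha> < 1" "norm \<beta> < 1"
      "{f \<in> hardy2. ?L f = 0 \<and> ?M f = 0} =
        (\<lambda>h z. blaschke_factor \<alpha> z * blaschke_factor \<beta> z * h z) ` hardy2"
      using shift_invariant_kernel_Int[of ?L ?M, OF hardy_linear_inner[OF v(1)] shift_null_inner[OF v(1)]
          hardy_linear_inner[OF w] shift_null_inner[OF w] True inv] .
    have "hardy_kernel (\<lambda>f z. f z - hardy_adjoint T (T f) z) =
        (\<lambda>h z. blaschke_factor \<alpha> z * blaschke_factor \<beta> z * h z) ` hardy2"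
      unfolding kernel ab(3)[symmetric] using D by blast
    then show ?thesis
      using ab(1,2)
      by (intro exI[of _ "\<lambda>z. blaschke_factor \<alpha> z * blaschke_factor \<beta> z"] conjI disjI2
          bexI[of _ \<alpha>] bexI[of _ \<beta>]) simp_all
  next
    case False
    then obtain a b where ab: "\<And>f. f \<in> hardy2 \<Longrightarrow> a * ?L f + b * ?M f = 0" "a \<noteq> 0 \<or> b \<noteq> 0"
      unfolding hardy_independent_def by blast
    have dep: "cnj a * v z + cnj b * w z = 0" for z
      using inner_functional_dependent[OF v(1) w ab(1)] .
    \<comment> \<open>If b were 0, then a would be nonzero and \<open>dep\<close> would force v =
      0.\<close>
    have b: "b \<noteq> 0"
      using dep v(2) ab(2) by (auto simp: fun_eq_iff)
    define \<mu> where "\<mu> = - (a / b)"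
    have M: "?M f = \<mu> * ?L f" if "f \<in> hardy2" for f
      using ab(1)[OF that] b by (simp add: \<mu>_def field_simps add_eq_0_iff)
    have w_eq: "w z = cnj \<mu> * v z" for z
      using dep[of z] b by (simp add: \<mu>_def field_simps add_eq_0_iff)
    \<comment> \<open>With w a multiple of v, the operator \<open>D\<close> collapses to \<kappa>
      times the rank-one operator of v with itself; \<open>f1\<close> then shows that \<kappa> and
      the functional of v are nonzero.\<close>
    define \<kappa> where "\<kappa> = cnj \<mu> + \<mu> + hardy_inner u u"
    have D_eq: "D f = (\<lambda>z. \<kappa> * ?L f * v z)" if "f \<in> hardy2" for f
      by (simp add: D_def M[OF that] w_eq \<kappa>_def algebra_simps)
    have nz: "\<kappa> \<noteq> 0" "?L f1 \<noteq> 0"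
      using f1 D_eq by auto
    have D: "D f = (\<lambda>z. 0) \<longleftrightarrow> ?L f = 0" if f: "f \<in> hardy2" for f
      using nz(1) v(2) by (auto simp: D_eq[OF f] fun_eq_iff)
    have inv: "?L (hardy_shift f) = 0" if "f \<in> hardy2" "?L f = 0" for f
      using that D D_T T_hardy2 T_shift by metis
    obtain \<alpha> where \<alpha>: "norm \<alpha> < 1"
      "{f \<in> hardy2. ?L f = 0} = (\<lambda>h z. blaschke_factor \<alpha> z * h z) ` hardy2"
      using shift_invariant_kernel[of ?L, OF hardy_linear_inner[OF v(1)] shift_null_inner[OF v(1)]
          inv f1(1) nz(2)] .
    have "hardy_kernel (\<lambda>f z. f z - hardy_adjoint T (T f) z) =
        (\<lambda>h z. blaschke_factor \<alpha> z * h z) ` hardy2"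
      unfolding kernel \<alpha>(2)[symmetric] using D by blast
    then show ?thesis
      using \<alpha>(1) by (intro exI[of _ "blaschke_factor \<alpha>"]) auto
  qed
qed

end
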